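(* Let $\{X_t\}_{t\ge 0}$ be a stationary stochastic process with values in a finite set $\{\beta_0,\ldots,\beta_{L-1}\}$, with block entropies $H_r$ and predictability gains $\mathcal{G}_u$. The total predictability gain, defined as $G_T=\sum_{l=0}^{\infty}\mathcal{G}_l$, satisfies $$G_T=H_1-h,$$ where $h=\lim_{r\to\infty}\frac{H_r}{r}$ is the entropy rate of the process.
   Context: For $r\ge1$, $p(\beta_{i_1},\ldots,\beta_{i_r})$ denotes the probability that $r$ consecutive values of the process are $\beta_{i_1},\ldots,\beta_{i_r}$ in temporal order (independent of the starting time by stationarity). The block entropy of size $r\ge 1$ is $H_r=-\sum_{i_1,\ldots,i_r=0}^{L-1}p(\beta_{i_1},\ldots,\beta_{i_r})\ln p(\beta_{i_1},\ldots,\beta_{i_r})$ (with $0\ln 0=0$), and $H_0=0$. The predictability gain is, for integer $u\ge 0$, $$\mathcal{G}_u=-(H_{u+2}-2H_{u+1}+H_u).$$ *)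

theory Defs
  imports "HOL-Probability.Probability"
begin

text \<open>Strict stationarity: all finite-dimensional distributions are invariant under time shifts.\<close>

definition stationary_process ::
  "'a measure \<Rightarrow> 'b measure \<Rightarrow> (nat \<Rightarrow> 'a \<Rightarrow> 'b) \<Rightarrow> bool" where
  "stationary_process M N X \<longleftrightarrow>
     (\<forall>t. X t \<in> measurable M N) \<and>
     (\<forall>J k. finite J \<longrightarrow>
        distr M (\<Pi>\<^sub>M j\<in>J. N) (\<lambda>\<omega>. \<lambda>j\<in>J. X (j + k) \<omega>) =
        distr M (\<Pi>\<^sub>M j\<in>J. N) (\<lambda>\<omega>. \<lambda>j\<in>J. X j \<omega>))"

text \<open>The blocks below start at time \<open>0\<close>; for a stationary process the starting time
  is irrelevant, see \<open>block_prob_shift\<close>.\<close>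

definition block_prob ::
  "'a measure \<Rightarrow> (nat \<Rightarrow> 'a \<Rightarrow> 'b) \<Rightarrow> nat \<Rightarrow> (nat \<Rightarrow> 'b) \<Rightarrow> real" where
  "block_prob M X r b = measure M {\<omega> \<in> space M. \<forall>j<r. X j \<omega> = b j}"

definition block_entropy ::
  "'a measure \<Rightarrow> (nat \<Rightarrow> 'a \<Rightarrow> 'b) \<Rightarrow> (nat \<Rightarrow> 'b) \<Rightarrow> nat \<Rightarrow> nat \<Rightarrow> real" where
  "block_entropy M X \<beta> L r =
     (if r = 0 then 0
      else - (\<Sum>i \<in> {..<r} \<rightarrow>\<^sub>E {..<L}.
                block_prob M X r (\<lambda>j. \<beta> (i j)) * ln (block_prob M X r (\<lambda>j. \<beta> (i j)))))"

definition predictability_gain ::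
  "'a measure \<Rightarrow> (nat \<Rightarrow> 'a \<Rightarrow> 'b) \<Rightarrow> (nat \<Rightarrow> 'b) \<Rightarrow> nat \<Rightarrow> nat \<Rightarrow> real" where
  "predictability_gain M X \<beta> L u =
     - (block_entropy M X \<beta> L (u + 2) - 2 * block_entropy M X \<beta> L (u + 1)
        + block_entropy M X \<beta> L u)"

definition total_predictability_gain ::
  "'a measure \<Rightarrow> (nat \<Rightarrow> 'a \<Rightarrow> 'b) \<Rightarrow> (nat \<Rightarrow> 'b) \<Rightarrow> nat \<Rightarrow> real" where
  "total_predictability_gain M X \<beta> L = (\<Sum>l. predictability_gain M X \<beta> L l)"

definition entropy_rate ::
  "'a measure \<Rightarrow> (nat \<Rightarrow> 'a \<Rightarrow> 'b) \<Rightarrow> (nat \<Rightarrow> 'b) \<Rightarrow> nat \<Rightarrow> real" where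
  "entropy_rate M X \<beta> L = lim (\<lambda>r. block_entropy M X \<beta> L r / real r)"

lemma block_prob_shift:
  assumes st: "stationary_process M (count_space S) X" and b: "\<And>j. j < r \<Longrightarrow> b j \<in> S"
  shows "measure M {\<omega> \<in> space M. \<forall>j<r. X (t + j) \<omega> = b j} = block_prob M X r b"
proof -
  define P where "P = (\<Pi>\<^sub>M j\<in>{..<r}. count_space S)"
  define A where "A = (\<Pi>\<^sub>E j\<in>{..<r}. {b j})"
  define Y where "Y = (\<lambda>k \<omega>. \<lambda>j\<in>{..<r}. X (j + k) \<omega>)"
  have X: "X s \<in> measurable M (count_space S)" for s
    using st unfolding stationary_process_def by blast
  have A: "A \<in> sets P"
    unfolding A_def P_def
  proof (rule sets_PiM_I_finite)
    show "finite {..<r}" by (rule finite_lessThan)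
    show "{b j} \<in> sets (count_space S)" if "j \<in> {..<r}" for j
      using b that by simp
  qed
  have Y: "Y k \<in> measurable M P" for k
    unfolding Y_def P_def by (rule measurable_restrict) (rule X)
  have vimage: "Y k -` A \<inter> space M = {\<omega> \<in> space M. \<forall>j<r. X (k + j) \<omega> = b j}" for k
  proof -
    have "Y k \<omega> \<in> A \<longleftrightarrow> (\<forall>j<r. X (j + k) \<omega> = b j)" for \<omega>
      unfolding Y_def A_def restrict_PiE_iff by blast
    then show ?thesis
      unfolding add.commute[of k] by blast
  qed
  have law: "measure (distr M P (Y k)) A = measure M {\<omega> \<in> space M. \<forall>j<r. X (k + j) \<omega> = b j}" for k
    unfolding measure_distr[OF Y A] vimage ..
  have "distr M P (Y t) = distr M P (Y 0)"
    using st finite_lessThan[of r] unfolding stationary_process_def P_def Y_def add_0_right by blast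
  then have "measure (distr M P (Y t)) A = measure (distr M P (Y 0)) A"
    by (rule arg_cong)
  then show ?thesis
    unfolding law block_prob_def add_0_left .
qed

end

theory Submission
  imports Defs
begin

text \<open>
  Conditioning reduces entropy, so \<open>H\<close> is nondecreasing, and stationarity together with
  strong subadditivity of the Shannon entropy makes \<open>H\<close> concave. Hence the increments
  \<open>H (r + 1) - H r\<close> decrease to a limit, which by averaging is the entropy rate \<open>h\<close>. Each
  gain is the difference of two consecutive increments, and the series telescopes to \<open>H 1 - h\<close>.
\<close>

section \<open>Cesaro averaging of increments\<close>

text \<open>Once the increments are within \<open>e / 2\<close> of \<open>l\<close>, the defect
  \<open>a n - real n * l\<close> drifts by at most \<open>e / 2\<close> per step, and the defect
  \<open>C\<close> at the starting index is negligible after division by \<open>n\<close>.\<close>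

lemma LIMSEQ_divide_of_increments:
  fixes a :: "nat \<Rightarrow> real"
  assumes "(\<lambda>n. a (Suc n) - a n) \<longlonglongrightarrow> l"
  shows "(\<lambda>n. a n / real n) \<longlonglongrightarrow> l"
proof (rule LIMSEQ_I)
  fix e :: real assume e: "e > 0"
  obtain N where N: "\<And>n. n \<ge> N \<Longrightarrow> \<bar>a (Suc n) - a n - l\<bar> < e / 2"
    using LIMSEQ_D[OF assms, of "e / 2"] e by (auto simp: real_norm_def)
  define C where "C = \<bar>a N - real N * l\<bar>"
  have growth: "\<bar>a n - real n * l\<bar> \<le> C + real n * (e / 2)" if "n \<ge> N" for n
    using that
  proof (induction n rule: dec_induct)
    case base
    then show ?case using e by (simp add: C_def)
  next
    case (step n)
    have "a (Suc n) - real (Suc n) * l = (a n - real n * l) + (a (Suc n) - a n - l)"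
      by (simp add: algebra_simps)
    moreover have "real (Suc n) * (e / 2) = real n * (e / 2) + e / 2"
      by (simp add: algebra_simps)
    ultimately show ?case
      using step.IH N[OF step.hyps(1)] by linarith
  qed
  obtain K where K: "real K > 2 * C / e"
    using reals_Archimedean2 by blast
  \<comment> \<open>Drift and \<open>C\<close> each cost less than or at most half of
    \<open>e\<close>; \<open>Suc N\<close> instead of \<open>N\<close> keeps \<open>n\<close>
    positive for the division.\<close>
  have "norm (a n / real n - l) < e" if n: "n \<ge> max (Suc N) K" for n
  proof -
    have pos: "real n > 0" and "n \<ge> N" and "real n \<ge> real K"
      using n by auto
    have "2 * C / e < real n"
      using K \<open>real n \<ge> real K\<close> by linarith
    then have "C < real n * (e / 2)"
      using e by (simp add: field_simps)
    then have "\<bar>a n - real n * l\<bar> < real n * e"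
      using growth[OF \<open>n \<ge> N\<close>] by simp
    moreover have "a n / real n - l = (a n - real n * l) / real n"
      using pos by (simp add: field_simps)
    ultimately show ?thesis
      using pos by (simp add: abs_divide field_simps)
  qed
  then show "\<exists>n0. \<forall>n\<ge>n0. norm (a n / real n - l) < e"
    by blast
qed

section \<open>Entropy inequalities for finite nonnegative weights\<close>

text \<open>Every weight is at most the total and \<open>ln\<close> is monotone; weights equal to 0
  contribute nothing.\<close>

lemma sum_mult_ln_le:
  fixes f :: "'a \<Rightarrow> real"
  assumes "finite B" "\<And>b. b \<in> B \<Longrightarrow> f b \<ge> 0"
  shows "(\<Sum>b\<in>B. f b * ln (f b)) \<le> sum f B * ln (sum f B)"
proof -
  have "f b * ln (f b) \<le> f b * ln (sum f B)" if b: "b \<in> B" for b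
  proof (cases "f b = 0")
    case False
    then have "f b > 0" using assms(2)[OF b] by simp
    moreover have "f b \<le> sum f B" using assms b by (intro member_le_sum) auto
    ultimately show ?thesis by (intro mult_left_mono) auto
  qed simp
  then have "(\<Sum>b\<in>B. f b * ln (f b)) \<le> (\<Sum>b\<in>B. f b * ln (sum f B))"
    by (rule sum_mono)
  then show ?thesis by (simp add: sum_distrib_right)
qed

text \<open>This is nonnegativity of mutual information for joint weights \<open>f\<close> with
  marginals \<open>g\<close>, \<open>k\<close>: apply \<open>ln x \<le> x - 1\<close> to
  \<open>x = g a * k b / (c * f a b)\<close>, weight by \<open>f a b\<close> and sum. The mass
  \<open>c\<close> is left free so that it can be the probability of a fixed middle word, possibly
  zero.\<close>

lemma strong_subadditivity_unnormalized:
  fixes f :: "'a \<Rightarrow> 'b \<Rightarrow> real"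
  assumes fin: "finite A" "finite B"
    and nonneg: "\<And>a b. a \<in> A \<Longrightarrow> b \<in> B \<Longrightarrow> f a b \<ge> 0"
    and g: "\<And>a. a \<in> A \<Longrightarrow> (\<Sum>b\<in>B. f a b) = g a"
    and k: "\<And>b. b \<in> B \<Longrightarrow> (\<Sum>a\<in>A. f a b) = k b"
    and c: "(\<Sum>a\<in>A. g a) = c"
  shows "(\<Sum>a\<in>A. g a * ln (g a)) + (\<Sum>b\<in>B. k b * ln (k b))
           \<le> (\<Sum>a\<in>A. \<Sum>b\<in>B. f a b * ln (f a b)) + c * ln c"
proof -
  have g0: "g a \<ge> 0" if "a \<in> A" for a
    using nonneg that unfolding g[OF that, symmetric] by (intro sum_nonneg)
  have k0: "k b \<ge> 0" if "b \<in> B" for b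
    using nonneg that unfolding k[OF that, symmetric] by (intro sum_nonneg)
  have c0: "c \<ge> 0"
    unfolding c[symmetric] using g0 by (rule sum_nonneg)
  have ck: "sum k B = c"
  proof -
    have "sum k B = (\<Sum>b\<in>B. \<Sum>a\<in>A. f a b)" using k by simp
    also have "\<dots> = (\<Sum>a\<in>A. \<Sum>b\<in>B. f a b)" by (rule sum.swap)
    also have "\<dots> = c" using g c by simp
    finally show ?thesis .
  qed
  \<comment> \<open>Keeping the factor \<open>f a b\<close> covers empty cells: there the left side
    is 0 and the right side is nonnegative.\<close>
  have pointwise: "f a b * ln (g a) + f a b * ln (k b) - f a b * ln (f a b) - f a b * ln c
      \<le> g a * k b / c - f a b" if a: "a \<in> A" and b: "b \<in> B" for a b
  proof (cases "f a b = 0")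
    case True
    then show ?thesis using g0[OF a] k0[OF b] c0 by simp
  next
    case False
    then have f: "f a b > 0" using nonneg[OF a b] by simp
    have "f a b \<le> g a"
      unfolding g[OF a, symmetric] using nonneg a b fin by (intro member_le_sum) auto
    then have gp: "g a > 0" using f by simp
    have "f a b \<le> k b"
      unfolding k[OF b, symmetric] using nonneg a b fin
      by (intro member_le_sum[of a A "\<lambda>a. f a b"]) auto
    then have kp: "k b > 0" using f by simp
    have "g a \<le> c"
      unfolding c[symmetric] using g0 a fin by (intro member_le_sum) auto
    then have cp: "c > 0" using gp by simp
    have "ln (g a) + ln (k b) - ln (f a b) - ln c = ln (g a * k b / (c * f a b))"
      using gp kp f cp by (simp add: ln_mult ln_div)
    also have "\<dots> \<le> g a * k b / (c * f a b) - 1"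
      using gp kp f cp by (intro ln_le_minus_one) simp
    finally have "f a b * (ln (g a) + ln (k b) - ln (f a b) - ln c)
        \<le> f a b * (g a * k b / (c * f a b) - 1)"
      using f by (intro mult_left_mono) auto
    moreover have "f a b * (g a * k b / (c * f a b) - 1) = g a * k b / c - f a b"
      using f cp by (simp add: field_simps)
    ultimately show ?thesis by (simp add: algebra_simps)
  qed
  have "(\<Sum>a\<in>A. \<Sum>b\<in>B. f a b * ln (g a) + f a b * ln (k b) - f a b * ln (f a b) - f a b * ln c)
      \<le> (\<Sum>a\<in>A. \<Sum>b\<in>B. g a * k b / c - f a b)"
    by (intro sum_mono pointwise)
  also have "\<dots> = (\<Sum>a\<in>A. g a * sum k B / c - g a)"
    using g by (intro sum.cong refl)
      (simp add: sum_subtractf sum_distrib_left[symmetric] sum_divide_distrib[symmetric])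
  also have "\<dots> = (\<Sum>a\<in>A. g a * sum k B / c) - c"
    by (simp only: sum_subtractf c)
  \<comment> \<open>This is \<open>c * c / c = c\<close>, which also holds for \<open>c = 0\<close>
    because division by zero gives 0.\<close>
  also have "(\<Sum>a\<in>A. g a * sum k B / c) = c"
    unfolding ck sum_divide_distrib[symmetric] sum_distrib_right[symmetric] c by simp
  also have "c - c = 0"
    by simp
  finally have main:
    "(\<Sum>a\<in>A. \<Sum>b\<in>B. f a b * ln (g a)) + (\<Sum>a\<in>A. \<Sum>b\<in>B. f a b * ln (k b))
      - (\<Sum>a\<in>A. \<Sum>b\<in>B. f a b * ln (f a b)) - (\<Sum>a\<in>A. \<Sum>b\<in>B. f a b * ln c) \<le> 0"
    by (simp add: sum_subtractf sum.distrib)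
  have "(\<Sum>a\<in>A. \<Sum>b\<in>B. f a b * ln (g a)) = (\<Sum>a\<in>A. g a * ln (g a))"
    by (simp add: sum_distrib_right[symmetric] g)
  moreover have "(\<Sum>a\<in>A. \<Sum>b\<in>B. f a b * ln (k b)) = (\<Sum>b\<in>B. k b * ln (k b))"
    by (subst sum.swap) (simp add: sum_distrib_right[symmetric] k)
  moreover have "(\<Sum>a\<in>A. \<Sum>b\<in>B. f a b * ln c) = c * ln c"
    by (simp add: sum_distrib_right[symmetric] g c)
  ultimately show ?thesis using main by linarith
qed

section \<open>Sums over words split at the last or the first letter\<close>

lemma sum_PiE_snoc:
  "(\<Sum>i\<in>{..<Suc r} \<rightarrow>\<^sub>E A. F i) = (\<Sum>w\<in>{..<r} \<rightarrow>\<^sub>E A. \<Sum>b\<in>A. F (w(r := b)))"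
proof -
  have "(\<Sum>w\<in>{..<r} \<rightarrow>\<^sub>E A. \<Sum>b\<in>A. F (w(r := b)))
      = (\<Sum>(b, w)\<in>A \<times> ({..<r} \<rightarrow>\<^sub>E A). F (w(r := b)))"
    by (subst sum.swap) (simp add: sum.cartesian_product)
  also have "\<dots> = (\<Sum>i\<in>{..<Suc r} \<rightarrow>\<^sub>E A. F i)"
    unfolding lessThan_Suc PiE_insert_eq
    by (subst sum.reindex[OF inj_combinator]) (simp_all add: o_def case_prod_unfold)
  finally show ?thesis ..
qed

text \<open>\<open>case_nat\<close> shifts \<open>w\<close> by one place, including its
  \<open>undefined\<close> tail, so the longer word is again extensional; the inverse map reads off
  \<open>i 0\<close> and drops it.\<close>

lemma sum_PiE_Cons:
  "(\<Sum>i\<in>{..<Suc r} \<rightarrow>\<^sub>E A. F i) = (\<Sum>w\<in>{..<r} \<rightarrow>\<^sub>E A. \<Sum>a\<in>A. F (case_nat a w))"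
proof -
  have "(\<Sum>w\<in>{..<r} \<rightarrow>\<^sub>E A. \<Sum>a\<in>A. F (case_nat a w))
      = (\<Sum>(w, a)\<in>({..<r} \<rightarrow>\<^sub>E A) \<times> A. F (case_nat a w))"
    by (simp add: sum.cartesian_product)
  also have "\<dots> = (\<Sum>i\<in>{..<Suc r} \<rightarrow>\<^sub>E A. F i)"
  proof (rule sum.reindex_bij_witness
      [where i = "\<lambda>i. (\<lambda>j. i (Suc j), i 0)" and j = "\<lambda>(w, a). case_nat a w"])
    fix i assume i: "i \<in> {..<Suc r} \<rightarrow>\<^sub>E A"
    have "case_nat (i 0) (\<lambda>j. i (Suc j)) j = i j" for j
      by (cases j) simp_all
    then show "(case (\<lambda>j. i (Suc j), i 0) of (w, a) \<Rightarrow> case_nat a w) = i"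
      by auto
    show "(\<lambda>j. i (Suc j), i 0) \<in> ({..<r} \<rightarrow>\<^sub>E A) \<times> A"
      using i by (auto simp: PiE_iff extensional_def)
  next
    fix wa assume "wa \<in> ({..<r} \<rightarrow>\<^sub>E A) \<times> A"
    then obtain w a where wa: "wa = (w, a)" "w \<in> {..<r} \<rightarrow>\<^sub>E A" "a \<in> A"
      by blast
    show "(\<lambda>j. (case wa of (w, a) \<Rightarrow> case_nat a w) (Suc j),
        (case wa of (w, a) \<Rightarrow> case_nat a w) 0) = wa"
      by (simp add: wa(1))
    show "(case wa of (w, a) \<Rightarrow> case_nat a w) \<in> {..<Suc r} \<rightarrow>\<^sub>E A"
      using wa(2,3) unfolding wa(1)
      by (auto simp: PiE_iff extensional_def less_Suc_eq_0_disj split: nat.split)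
  qed (simp add: case_prod_unfold)
  finally show ?thesis ..
qed

section \<open>Block probabilities and their marginals\<close>

locale finite_stationary_process = prob_space M
  for M :: "'a measure" +
  fixes X :: "nat \<Rightarrow> 'a \<Rightarrow> 'b" and \<beta> :: "nat \<Rightarrow> 'b" and L :: nat
  assumes inj: "inj_on \<beta> {..<L}"
    and stationary: "stationary_process M (count_space (\<beta> ` {..<L})) X"
begin

definition p :: "nat \<Rightarrow> (nat \<Rightarrow> nat) \<Rightarrow> real" where
  "p r i = block_prob M X r (\<lambda>j. \<beta> (i j))"

abbreviation H :: "nat \<Rightarrow> real" where
  "H \<equiv> block_entropy M X \<beta> L"

lemma measurable_X: "X t \<in> measurable M (count_space (\<beta> ` {..<L}))"
  using stationary unfolding stationary_process_def by blast

lemma X_in_values: "\<omega> \<in> space M \<Longrightarrow> X t \<omega> \<in> \<beta> ` {..<L}"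
  using measurable_space[OF measurable_X] by simp

lemma event_X_eq: "{\<omega> \<in> space M. X t \<omega> = c} \<in> events"
proof -
  \<comment> \<open>Since \<open>c\<close> may lie outside the value set, it is first intersected
    with that set to get a measurable target.\<close>
  have "{\<omega> \<in> space M. X t \<omega> = c} = X t -` ({c} \<inter> \<beta> ` {..<L}) \<inter> space M"
    using X_in_values by blast
  then show ?thesis
    using measurable_sets[OF measurable_X, of "{c} \<inter> \<beta> ` {..<L}"] by simp
qed

lemma event_block: "{\<omega> \<in> space M. \<forall>j<r. X (t + j) \<omega> = b j} \<in> events"
  using sets.sets_Collect_finite_All[of "{..<r}" M "\<lambda>j \<omega>. X (t + j) \<omega> = b j"] event_X_eq
  by simp

text \<open>Injectivity of \<open>\<beta>\<close> makes the events for different letters disjoint,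
  and they exhaust the space because \<open>X t\<close> takes no other values.\<close>

lemma sum_prob_value:
  assumes Q: "{\<omega> \<in> space M. Q \<omega>} \<in> events"
  shows "(\<Sum>a<L. prob {\<omega> \<in> space M. X t \<omega> = \<beta> a \<and> Q \<omega>}) = prob {\<omega> \<in> space M. Q \<omega>}"
proof -
  let ?A = "\<lambda>a. {\<omega> \<in> space M. X t \<omega> = \<beta> a \<and> Q \<omega>}"
  have "?A a \<in> events" for a
    by (rule sets.sets_Collect_conj[OF Q event_X_eq])
  moreover have "disjoint_family_on ?A {..<L}"
    using inj unfolding disjoint_family_on_def inj_on_def by auto
  ultimately have "prob (\<Union>a<L. ?A a) = (\<Sum>a<L. prob (?A a))"
    by (intro finite_measure_finite_Union) auto
  moreover have "(\<Union>a<L. ?A a) = {\<omega> \<in> space M. Q \<omega>}"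
    using X_in_values by blast
  ultimately show ?thesis by simp
qed

lemma p_nonneg: "p r i \<ge> 0"
  by (simp add: p_def block_prob_def)

lemma sum_p_snoc: "(\<Sum>b<L. p (Suc r) (w(r := b))) = p r w"
proof -
  have "p (Suc r) (w(r := b))
      = prob {\<omega> \<in> space M. X r \<omega> = \<beta> b \<and> (\<forall>j<r. X j \<omega> = \<beta> (w j))}" for b
    unfolding p_def block_prob_def by (rule arg_cong[where f = prob]) (auto simp: less_Suc_eq)
  then have "(\<Sum>b<L. p (Suc r) (w(r := b)))
      = prob {\<omega> \<in> space M. \<forall>j<r. X j \<omega> = \<beta> (w j)}"
    using sum_prob_value[OF event_block[of r 0 "\<lambda>j. \<beta> (w j)"]] by simp
  then show ?thesis
    unfolding p_def[of r w] block_prob_def .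
qed

text \<open>Removing the first letter leaves a block that starts at time 1; stationarity moves it
  back to time 0. The condition on \<open>w\<close> puts its letters in the value set, as the shift
  requires.\<close>

lemma sum_p_Cons:
  assumes w: "w \<in> {..<r} \<rightarrow>\<^sub>E {..<L}"
  shows "(\<Sum>a<L. p (Suc r) (case_nat a w)) = p r w"
proof -
  have "p (Suc r) (case_nat a w)
      = prob {\<omega> \<in> space M. X 0 \<omega> = \<beta> a \<and> (\<forall>j<r. X (1 + j) \<omega> = \<beta> (w j))}" for a
    unfolding p_def block_prob_def by (rule arg_cong[where f = prob]) (auto simp: All_less_Suc2)
  then have "(\<Sum>a<L. p (Suc r) (case_nat a w))
      = prob {\<omega> \<in> space M. \<forall>j<r. X (1 + j) \<omega> = \<beta> (w j)}"
    using sum_prob_value[OF event_block[of r 1 "\<lambda>j. \<beta> (w j)"]] by simp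
  also have "\<dots> = p r w"
    unfolding p_def using w by (intro block_prob_shift[OF stationary]) (auto dest: PiE_mem)
  finally show ?thesis .
qed

section \<open>Monotonicity and concavity of the block entropy\<close>

text \<open>For \<open>r = 0\<close> the only word is the empty one, with probability 1, so its term
  \<open>1 * ln 1\<close> agrees with the default 0.\<close>

lemma block_entropy_eq: "H r = - (\<Sum>i\<in>{..<r} \<rightarrow>\<^sub>E {..<L}. p r i * ln (p r i))"
  by (simp add: block_entropy_def p_def block_prob_def prob_space)

lemma block_entropy_mono: "H r \<le> H (Suc r)"
proof -
  have "(\<Sum>b<L. p (Suc r) (w(r := b)) * ln (p (Suc r) (w(r := b)))) \<le> p r w * ln (p r w)" for w
    using sum_mult_ln_le[of "{..<L}" "\<lambda>b. p (Suc r) (w(r := b))"] p_nonneg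
    by (simp add: sum_p_snoc)
  then show ?thesis
    unfolding block_entropy_eq sum_PiE_snoc by (simp add: sum_mono)
qed

text \<open>Given the middle word \<open>w\<close> of length \<open>u\<close>, the first letter
  \<open>a\<close> and last letter \<open>b\<close> have joint weights \<open>?f w a b\<close>.
  Summed over \<open>w\<close>, strong subadditivity says that their conditional mutual information,
  which is the gain at \<open>u\<close>, is nonnegative.\<close>

lemma block_entropy_concave: "H (Suc (Suc u)) + H u \<le> 2 * H (Suc u)"
proof -
  let ?W = "{..<u} \<rightarrow>\<^sub>E {..<L}"
  let ?f = "\<lambda>w a b. p (Suc (Suc u)) (case_nat a (w(u := b)))"
  \<comment> \<open>The last letter sits at position \<open>Suc u\<close> of the full word, the form
    that \<open>sum_p_snoc\<close> needs.\<close>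
  have shift: "case_nat a (w(u := b)) = (case_nat a w)(Suc u := b)" for a b and w :: "nat \<Rightarrow> nat"
    by (auto simp: fun_eq_iff split: nat.splits)
  have local: "(\<Sum>a<L. p (Suc u) (case_nat a w) * ln (p (Suc u) (case_nat a w)))
      + (\<Sum>b<L. p (Suc u) (w(u := b)) * ln (p (Suc u) (w(u := b))))
      \<le> (\<Sum>a<L. \<Sum>b<L. ?f w a b * ln (?f w a b)) + p u w * ln (p u w)" if w: "w \<in> ?W" for w
  proof (rule strong_subadditivity_unnormalized)
    show "(\<Sum>b<L. ?f w a b) = p (Suc u) (case_nat a w)" for a
      unfolding shift by (rule sum_p_snoc)
    show "(\<Sum>a<L. ?f w a b) = p (Suc u) (w(u := b))" if "b \<in> {..<L}" for b
      using w that by (intro sum_p_Cons) (simp add: lessThan_Suc PiE_fun_upd)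
    show "(\<Sum>a<L. p (Suc u) (case_nat a w)) = p u w"
      by (rule sum_p_Cons[OF w])
  qed (auto simp: p_nonneg)
  have H2: "H (Suc (Suc u)) = - (\<Sum>w\<in>?W. \<Sum>a<L. \<Sum>b<L. ?f w a b * ln (?f w a b))"
    unfolding block_entropy_eq sum_PiE_Cons[where r = "Suc u"] sum_PiE_snoc[where r = u]
    by (intro arg_cong[where f = uminus] sum.cong refl sum.swap)
  have "(\<Sum>w\<in>?W. (\<Sum>a<L. p (Suc u) (case_nat a w) * ln (p (Suc u) (case_nat a w)))
      + (\<Sum>b<L. p (Suc u) (w(u := b)) * ln (p (Suc u) (w(u := b)))))
      \<le> (\<Sum>w\<in>?W. (\<Sum>a<L. \<Sum>b<L. ?f w a b * ln (?f w a b)) + p u w * ln (p u w))"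
    by (rule sum_mono) (rule local)
  \<comment> \<open>Both marginals run over all words of length \<open>Suc u\<close>, once by first
    and once by last letter; hence the factor 2.\<close>
  moreover have "(\<Sum>w\<in>?W. \<Sum>a<L. p (Suc u) (case_nat a w) * ln (p (Suc u) (case_nat a w)))
      = - H (Suc u)"
    unfolding block_entropy_eq sum_PiE_Cons by simp
  moreover have "(\<Sum>w\<in>?W. \<Sum>b<L. p (Suc u) (w(u := b)) * ln (p (Suc u) (w(u := b))))
      = - H (Suc u)"
    unfolding block_entropy_eq sum_PiE_snoc by simp
  ultimately show ?thesis
    using H2 block_entropy_eq[of u] by (simp add: sum.distrib)
qed

text \<open>Concavity makes the increments nonincreasing, and monotonicity bounds them below by
  0.\<close>

lemma block_entropy_increments_converge:
  obtains h where "(\<lambda>r. H (Suc r) - H r) \<longlonglongrightarrow> h"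
proof -
  have "decseq (\<lambda>r. H (Suc r) - H r)"
    using block_entropy_concave by (intro decseq_SucI) (simp add: algebra_simps)
  moreover have "\<forall>r. 0 \<le> H (Suc r) - H r"
    using block_entropy_mono by simp
  ultimately show ?thesis
    using that by (rule decseq_convergent)
qed

end

text \<open>\<open>lim\<close> and \<open>suminf\<close> are total, so the equation alone would not
  assert that the limit and the sum exist; the first two conjuncts do.\<close>

theorem proposition2:
  fixes M :: "'a measure" and X :: "nat \<Rightarrow> 'a \<Rightarrow> 'b" and \<beta> :: "nat \<Rightarrow> 'b" and L :: nat
  assumes "prob_space M"
    and "inj_on \<beta> {..<L}"
    and "stationary_process M (count_space (\<beta> ` {..<L})) X"
  shows "convergent (\<lambda>r. block_entropy M X \<beta> L r / real r) \<and>
    summable (predictability_gain M X \<beta> L) \<and>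
    total_predictability_gain M X \<beta> L = block_entropy M X \<beta> L 1 - entropy_rate M X \<beta> L"
proof -
  interpret finite_stationary_process M X \<beta> L
    using assms by (intro finite_stationary_process.intro finite_stationary_process_axioms.intro)
  obtain h where h: "(\<lambda>r. H (Suc r) - H r) \<longlonglongrightarrow> h"
    by (rule block_entropy_increments_converge)
  have rate: "(\<lambda>r. H r / real r) \<longlonglongrightarrow> h"
    using h by (rule LIMSEQ_divide_of_increments)
  have "predictability_gain M X \<beta> L
      = (\<lambda>u. (H (Suc u) - H u) - (H (Suc (Suc u)) - H (Suc u)))"
    by (simp add: predictability_gain_def fun_eq_iff)
  \<comment> \<open>The telescoping sum starts at the increment \<open>H 1 - H 0\<close>, which is
    therefore \<open>H 1\<close>.\<close>
  moreover have "H 0 = 0"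
    by (simp add: block_entropy_def)
  ultimately have "predictability_gain M X \<beta> L sums (H 1 - h)"
    using telescope_sums'[OF h] by simp
  moreover have "entropy_rate M X \<beta> L = h"
    unfolding entropy_rate_def using rate by (rule limI)
  ultimately show ?thesis
    using rate unfolding total_predictability_gain_def
    by (auto simp: convergent_def sums_iff)
qed

end
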